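(* Let $d\ge1$ and let $f$ be a solution, with $f>0$ and $|f'|<1$, on some $[t_0,\infty)$ of $$[1-(f')^2]\,d+f f''=(d+1)[1-(f')^2]^{3/2}f$$ which expands indefinitely, i.e. $\lim_{t\to\infty}f(t)=\infty$. Then there exists a constant $\tau_0\in\mathbb{R}$ such that $$\lim_{t\to\infty}\big|f(t)-(t-\tau_0)\big|=0 .$$
   Context: The equation expresses that the spherically symmetric time-like hypersurface $\{r=f(t)\}\subset\mathbb{R}^{1,d+1}$ has constant mean curvature $d+1$. *)

theory Defs
  imports Complex_Main
begin

text \<open>
  The profile equation for the hypersurface \<open>r = f t\<close> in \<open>(1+(d+1))\<close>-dimensional Minkowski space
  to be time-like with constant mean curvature \<open>d + 1\<close>. At the endpoint \<open>t0\<close> the derivatives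
  are one-sided. Since \<open>\<bar>f' t\<bar> < 1\<close>, the base of \<open>powr\<close> is positive; since \<open>f t > 0\<close>, the
  equation itself makes \<open>f''\<close> continuous, so a solution is automatically of class \<open>C\<^sup>2\<close>.
\<close>

definition cmc_solution :: "nat \<Rightarrow> real \<Rightarrow> (real \<Rightarrow> real) \<Rightarrow> bool" where
  "cmc_solution d t0 f \<longleftrightarrow>
    (\<exists>f' f''. \<forall>t\<ge>t0.
      (f has_real_derivative f' t) (at t within {t0..}) \<and>
      (f' has_real_derivative f'' t) (at t within {t0..}) \<and>
      f t > 0 \<and> \<bar>f' t\<bar> < 1 \<and>
      (1 - (f' t)\<^sup>2) * real d + f t * f'' t
        = (real d + 1) * (1 - (f' t)\<^sup>2) powr (3/2) * f t)"

end

theory Submission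
  imports Defs
begin

text \<open>
  The equation has a first integral: with the Lorentz factor \<open>\<gamma> = 1 / sqrt (1 - (f')\<^sup>2)\<close>, the
  quantity \<open>f ^ d * \<gamma> - f ^ (d + 1)\<close> is constant along every solution
  (\<open>cmc_first_integral\<close>). Calling the constant \<open>C\<close>, one has \<open>\<gamma> = f + C / f ^ d\<close>, so if \<open>f\<close>
  tends to infinity then \<open>\<gamma> \<ge> f / 2\<close> at late times, that is, \<open>1 - (f')\<^sup>2 \<le> 4 / f\<^sup>2\<close>
  (\<open>cmc_nearly_lightlike\<close>). In particular \<open>f'\<close> stays away from \<open>0\<close>; it then keeps its sign, and the
  sign is positive since \<open>f\<close> grows. The speed deficit thus satisfies \<open>0 < 1 - f' \<le> 4 / f\<^sup>2\<close> with
  \<open>f\<close> growing at least linearly, so it is integrable and \<open>t - f t\<close> converges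
  (\<open>asymptotic_to_unit_speed\<close>); the limit is \<open>\<tau>0\<close>.
\<close>

lemma mono_bounded_imp_convergent_at_top:
  fixes g :: "real \<Rightarrow> real"
  assumes mono: "\<And>s t. T \<le> s \<Longrightarrow> s \<le> t \<Longrightarrow> g s \<le> g t"
    and bound: "\<And>t. T \<le> t \<Longrightarrow> g t \<le> B"
  shows "\<exists>L. (g \<longlongrightarrow> L) at_top"
proof -
  have bdd: "bdd_above (g ` {T..})"
    using bound by (auto intro!: bdd_aboveI)
  have "(g \<longlongrightarrow> (SUP t\<in>{T..}. g t)) at_top"
  proof (rule increasing_tendsto)
    show "\<forall>\<^sub>F t in at_top. g t \<le> (SUP t\<in>{T..}. g t)"
      using eventually_ge_at_top[of T] by eventually_elim (auto intro: cSUP_upper bdd)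
  next
    fix x assume "x < (SUP t\<in>{T..}. g t)"
    then obtain s where "s \<ge> T" "x < g s"
      using less_cSUP_iff[of "{T..}" g x] bdd by auto
    then show "\<forall>\<^sub>F t in at_top. x < g t"
      by (intro eventually_mono[OF eventually_ge_at_top[of s]]) (meson less_le_trans mono)
  qed
  then show ?thesis ..
qed

text \<open>
  Bounding \<open>t - f t\<close> amounts to integrating \<open>1 - f' \<le> K / f\<^sup>2\<close>. Since \<open>f' \<ge> 1/2\<close>, the right-hand
  side is at most \<open>2 * K * f' / f\<^sup>2\<close>, the derivative of \<open>- 2 * K / f\<close>; hence \<open>t - f t + 2 * K / f t\<close>
  is nonincreasing, and its value at \<open>T\<close> bounds \<open>t - f t\<close> from above.
\<close>
lemma asymptotic_to_unit_speed:
  fixes f f' :: "real \<Rightarrow> real"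
  assumes deriv: "\<And>t. T \<le> t \<Longrightarrow> (f has_real_derivative f' t) (at t)"
    and pos: "\<And>t. T \<le> t \<Longrightarrow> f t > 0"
    and lower: "\<And>t. T \<le> t \<Longrightarrow> 1/2 \<le> f' t"
    and upper: "\<And>t. T \<le> t \<Longrightarrow> f' t \<le> 1"
    and deficit: "\<And>t. T \<le> t \<Longrightarrow> 1 - f' t \<le> K / (f t)\<^sup>2"
    and K: "K \<ge> 0"
  shows "\<exists>\<tau>. ((\<lambda>t. t - f t) \<longlongrightarrow> \<tau>) at_top"
proof (rule mono_bounded_imp_convergent_at_top)
  fix s t assume st: "T \<le> s" "s \<le> t"
  show "s - f s \<le> t - f t"
  proof (rule DERIV_nonneg_imp_nondecreasing[OF st(2)])
    fix x assume "s \<le> x"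
    then have "T \<le> x" using st by simp
    then have "((\<lambda>t. t - f t) has_real_derivative 1 - f' x) (at x)" "0 \<le> 1 - f' x"
      using upper by (auto intro!: derivative_eq_intros deriv)
    then show "\<exists>y. ((\<lambda>t. t - f t) has_real_derivative y) (at x) \<and> 0 \<le> y" by blast
  qed
next
  fix t assume t: "T \<le> t"
  have "t - f t + 2 * K / f t \<le> T - f T + 2 * K / f T"
  proof (rule DERIV_nonpos_imp_nonincreasing[OF t])
    fix x assume "T \<le> x"
    note fx = deriv[OF this] pos[OF this] lower[OF this] deficit[OF this]
    have "((\<lambda>t. t - f t + 2 * K / f t) has_real_derivative 1 - f' x - 2 * f' x * (K / (f x)\<^sup>2))
        (at x)"
      using fx(1,2)
      by (auto intro!: derivative_eq_intros simp: power2_eq_square field_simps)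
    moreover have "1 * (K / (f x)\<^sup>2) \<le> 2 * f' x * (K / (f x)\<^sup>2)"
      using fx(3) K by (intro mult_right_mono) auto
    then have "1 - f' x - 2 * f' x * (K / (f x)\<^sup>2) \<le> 0"
      using fx(4) by linarith
    ultimately show "\<exists>y. ((\<lambda>t. t - f t + 2 * K / f t) has_real_derivative y) (at x) \<and> y \<le> 0"
      by blast
  qed
  moreover have "0 \<le> 2 * K / f t" using K pos[OF t] by simp
  ultimately show "t - f t \<le> T - f T + 2 * K / f T" by linarith
qed

text \<open>
  Multiplying the equation by \<open>f ^ (d - 1) * f' * \<gamma> ^ 3\<close> turns its left-hand side into the
  derivative of \<open>f ^ d * \<gamma>\<close> and its right-hand side into that of \<open>f ^ (d + 1)\<close>.
\<close>
lemma cmc_first_integral_deriv: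
  fixes f f' :: "real \<Rightarrow> real"
  assumes f: "(f has_real_derivative f' t) (at t)"
    and f': "(f' has_real_derivative c) (at t)"
    and pos: "f t > 0" and lt1: "\<bar>f' t\<bar> < 1"
    and eq: "(1 - (f' t)\<^sup>2) * real d + f t * c = (real d + 1) * (1 - (f' t)\<^sup>2) powr (3/2) * f t"
  shows "((\<lambda>t. f t ^ d / sqrt (1 - (f' t)\<^sup>2) - f t ^ (d + 1)) has_real_derivative 0) (at t)"
proof -
  define w where "w = sqrt (1 - (f' t)\<^sup>2)"
  have base: "1 - (f' t)\<^sup>2 > 0"
    using lt1 by (simp add: abs_square_less_1)
  then have w: "w > 0" "w\<^sup>2 = 1 - (f' t)\<^sup>2"
    by (auto simp: w_def)
  have "(1 - (f' t)\<^sup>2) powr (3/2) = w powr 3"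
    using base by (simp add: w_def powr_half_sqrt[symmetric] powr_powr)
  also have "\<dots> = w ^ 3"
    using w(1) by simp
  finally have eq': "w\<^sup>2 * real d + f t * c = (real d + 1) * w ^ 3 * f t"
    using eq w(2) by simp
  have sqrt': "((\<lambda>t. sqrt (1 - (f' t)\<^sup>2)) has_real_derivative - (f' t * c / w)) (at t)"
    using base unfolding w_def
    by (auto intro!: derivative_eq_intros f' simp: field_simps)
  have "((\<lambda>t. f t ^ d / sqrt (1 - (f' t)\<^sup>2) - f t ^ (d + 1)) has_real_derivative
      (real d * f t ^ (d - 1) * f' t * w + f t ^ d * (f' t * c / w)) / w\<^sup>2
        - (real d + 1) * f t ^ d * f' t) (at t)"
  proof (rule DERIV_cong[OF DERIV_diff[OF DERIV_divide[OF DERIV_power[OF f] sqrt'] DERIV_power[OF f]]])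
    show "sqrt (1 - (f' t)\<^sup>2) \<noteq> 0"
      using w(1) by (simp flip: w_def)
  qed (unfold w_def[symmetric], simp add: power2_eq_square algebra_simps)
  also have "(real d * f t ^ (d - 1) * f' t * w + f t ^ d * (f' t * c / w)) / w\<^sup>2
      = f t ^ d * f' t / (f t * w ^ 3) * (w\<^sup>2 * real d + f t * c)"
    using w(1) pos by (cases d) (auto simp: field_simps power2_eq_square power3_eq_cube)
  also have "\<dots> - (real d + 1) * f t ^ d * f' t = 0"
    using w(1) pos unfolding eq' by (simp add: field_simps)
  finally show ?thesis .
qed

lemma cmc_first_integral:
  fixes f f' f'' :: "real \<Rightarrow> real"
  assumes "\<And>t. t > t0 \<Longrightarrow> (f has_real_derivative f' t) (at t)"
    and "\<And>t. t > t0 \<Longrightarrow> (f' has_real_derivative f'' t) (at t)"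
    and "\<And>t. t > t0 \<Longrightarrow> f t > 0" and "\<And>t. t > t0 \<Longrightarrow> \<bar>f' t\<bar> < 1"
    and "\<And>t. t > t0 \<Longrightarrow> (1 - (f' t)\<^sup>2) * real d + f t * f'' t
                        = (real d + 1) * (1 - (f' t)\<^sup>2) powr (3/2) * f t"
  obtains C where "\<And>t. t > t0 \<Longrightarrow> f t ^ d / sqrt (1 - (f' t)\<^sup>2) = f t ^ (d + 1) + C"
proof -
  let ?H = "\<lambda>t. f t ^ d / sqrt (1 - (f' t)\<^sup>2) - f t ^ (d + 1)"
  have "(?H has_real_derivative 0) (at t)" if "t > t0" for t
    using assms that by (intro cmc_first_integral_deriv)
  then have "?H t = ?H (t0 + 1)" if "t > t0" for t
    using that by (intro DERIV_isconst3[of t0 "max t (t0 + 1) + 1"]) auto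
  then show ?thesis
    by (intro that[of "?H (t0 + 1)"]) (simp add: algebra_simps)
qed

text \<open>
  The first integral gives \<open>\<gamma> = f + C / f ^ d\<close>. Once \<open>f \<ge> 1\<close> and \<open>f \<ge> 2 * \<bar>C\<bar>\<close>, the correction term
  is at most \<open>f / 2\<close> in absolute value, so \<open>\<gamma> \<ge> f / 2\<close>.
\<close>
lemma cmc_nearly_lightlike:
  fixes y v C :: real
  assumes y: "1 \<le> y" "2 * \<bar>C\<bar> \<le> y" and v: "\<bar>v\<bar> < 1"
    and eq: "y ^ d / sqrt (1 - v\<^sup>2) = y ^ (d + 1) + C"
  shows "1 - v\<^sup>2 \<le> 4 / y\<^sup>2"
proof -
  define w where "w = sqrt (1 - v\<^sup>2)"
  have "1 - v\<^sup>2 > 0"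
    using v by (simp add: abs_square_less_1)
  then have w: "w > 0" "w\<^sup>2 = 1 - v\<^sup>2"
    by (auto simp: w_def)
  have "y / 2 * 1 \<le> y / 2 * y ^ d"
    using y(1) by (intro mult_left_mono) auto
  then have "y ^ d * (y / 2) \<le> y ^ (d + 1) + C"
    using y(2) by (simp add: algebra_simps)
  also have "\<dots> = y ^ d * (1 / w)"
    using eq by (simp add: w_def)
  finally have "y / 2 \<le> 1 / w"
    by (rule mult_left_le_imp_le) (use y(1) in simp)
  then have "w \<le> 2 / y"
    using w(1) y(1) by (simp add: field_simps)
  then have "w\<^sup>2 \<le> (2 / y)\<^sup>2"
    using w(1) by (intro power_mono) auto
  then show ?thesis
    using w(2) by (simp add: power_divide)
qed

text \<open>
  If the derivative were negative somewhere, the intermediate value theorem would keep it negative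
  from then on, and \<open>f\<close> could not tend to infinity.
\<close>
lemma nonvanishing_deriv_pos_of_tendsto_at_top:
  fixes f f' :: "real \<Rightarrow> real"
  assumes deriv: "\<And>t. T \<le> t \<Longrightarrow> (f has_real_derivative f' t) (at t)"
    and cont: "\<And>t. T \<le> t \<Longrightarrow> isCont f' t"
    and nz: "\<And>t. T \<le> t \<Longrightarrow> f' t \<noteq> 0"
    and lim: "filterlim f at_top at_top"
    and s: "T \<le> s"
  shows "f' s > 0"
proof (rule ccontr)
  assume "\<not> f' s > 0"
  then have neg: "f' s \<le> 0" by simp
  have neg': "f' t \<le> 0" if "s \<le> t" for t
  proof (rule ccontr)
    assume "\<not> f' t \<le> 0"
    then have "\<exists>x\<ge>s. x \<le> t \<and> f' x = 0"
      using neg that s by (intro IVT) (auto intro: cont)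
    then show False
      using nz s by force
  qed
  have "f t \<le> f s" if "s \<le> t" for t
  proof (rule DERIV_nonpos_imp_nonincreasing[OF that])
    fix x assume "s \<le> x"
    then show "\<exists>y. (f has_real_derivative y) (at x) \<and> y \<le> 0"
      using deriv[of x] neg'[of x] s by auto
  qed
  moreover have "\<forall>\<^sub>F t in at_top. f t > f s \<and> s \<le> t"
    using lim by (intro eventually_conj) (auto simp: filterlim_at_top_dense eventually_ge_at_top)
  then obtain t where "f t > f s" "s \<le> t"
    unfolding eventually_at_top_linorder by blast
  ultimately show False
    by fastforce
qed

theorem corollary2p17:
  fixes d :: nat and t0 :: real and f :: "real \<Rightarrow> real"
  assumes "d \<ge> 1"
    and "cmc_solution d t0 f"
    and "filterlim f at_top at_top"
  shows "\<exists>\<tau>0::real. ((\<lambda>t. \<bar>f t - (t - \<tau>0)\<bar>) \<longlongrightarrow> 0) at_top"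
proof -
  obtain f' f'' where sol: "\<And>t. t \<ge> t0 \<Longrightarrow>
      (f has_real_derivative f' t) (at t within {t0..}) \<and>
      (f' has_real_derivative f'' t) (at t within {t0..}) \<and>
      f t > 0 \<and> \<bar>f' t\<bar> < 1 \<and>
      (1 - (f' t)\<^sup>2) * real d + f t * f'' t
        = (real d + 1) * (1 - (f' t)\<^sup>2) powr (3/2) * f t"
    using assms(2) unfolding cmc_solution_def by blast
  have deriv: "(f has_real_derivative f' t) (at t)" "(f' has_real_derivative f'' t) (at t)"
    if "t > t0" for t
  proof -
    have *: "(g has_real_derivative D) (at t)"
      if "(g has_real_derivative D) (at t within {t0..})" for g D
      using DERIV_subset[OF that, of "{t0<..}"] \<open>t > t0\<close> at_within_open[of t "{t0<..}"]
      by (auto simp: subset_iff)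
    show "(f has_real_derivative f' t) (at t)" "(f' has_real_derivative f'' t) (at t)"
      by (rule *, use sol[of t] \<open>t > t0\<close> in simp)+
  qed
  obtain C where C: "\<And>t. t > t0 \<Longrightarrow> f t ^ d / sqrt (1 - (f' t)\<^sup>2) = f t ^ (d + 1) + C"
  proof (rule cmc_first_integral[of t0 f f' f'' d])
    fix t assume "t > t0"
    then show "f t > 0" "\<bar>f' t\<bar> < 1"
      "(1 - (f' t)\<^sup>2) * real d + f t * f'' t = (real d + 1) * (1 - (f' t)\<^sup>2) powr (3/2) * f t"
      using sol[of t] by simp_all
  qed (use deriv in blast)+
  \<comment> \<open>The bound \<open>4 \<le> f\<close> makes \<open>(f')\<^sup>2 \<ge> 3/4\<close>, so that \<open>\<bar>f'\<bar> \<ge> 1/2\<close>.\<close>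
  have "\<forall>\<^sub>F t in at_top. max 4 (2 * \<bar>C\<bar>) \<le> f t \<and> t0 < t"
    by (intro eventually_conj eventually_gt_at_top assms(3)[unfolded filterlim_at_top, rule_format])
  then obtain T where T: "\<And>t. T \<le> t \<Longrightarrow> 4 \<le> f t \<and> 2 * \<bar>C\<bar> \<le> f t \<and> t0 < t"
    by (auto simp: eventually_at_top_linorder)
  have lt1: "\<bar>f' t\<bar> < 1" if "T \<le> t" for t
    using sol[of t] T[OF that] by simp
  have light: "1 - (f' t)\<^sup>2 \<le> 4 / (f t)\<^sup>2" if "T \<le> t" for t
    using T[OF that] lt1[OF that] C[of t] by (intro cmc_nearly_lightlike[of "f t" C _ d]) auto
  have half: "1/2 \<le> \<bar>f' t\<bar>" if "T \<le> t" for t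
  proof -
    have "4\<^sup>2 \<le> (f t)\<^sup>2"
      using T[OF that] by (intro power_mono) auto
    then have "4 / (f t)\<^sup>2 \<le> 4 / 4\<^sup>2"
      using T[OF that] by (intro divide_left_mono) auto
    then have "(1/2)\<^sup>2 \<le> \<bar>f' t\<bar>\<^sup>2"
      using light[OF that] by (simp add: power2_eq_square)
    then show ?thesis
      by (rule power2_le_imp_le) simp
  qed
  have pos: "f' t > 0" if "T \<le> t" for t
  proof (rule nonvanishing_deriv_pos_of_tendsto_at_top[of T f f'])
    show "isCont f' t" if "T \<le> t" for t
      using deriv(2)[of t] T[OF that] by (auto intro: DERIV_isCont)
    show "f' t \<noteq> 0" if "T \<le> t" for t
      using half[OF that] by auto
  qed (use deriv T assms(3) that in auto)
  have "\<exists>\<tau>. ((\<lambda>t. t - f t) \<longlongrightarrow> \<tau>) at_top"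
  proof (rule asymptotic_to_unit_speed[of T f f' 4])
    fix t assume t: "T \<le> t"
    show "1/2 \<le> f' t" "f' t \<le> 1" "f t > 0" "(f has_real_derivative f' t) (at t)"
      using half[OF t] pos[OF t] lt1[OF t] T[OF t] deriv(1)[of t] by auto
    \<comment> \<open>\<open>1 - (f')\<^sup>2 = (1 - f') * (1 + f')\<close> dominates \<open>1 - f'\<close> because \<open>0 < f' < 1\<close>.\<close>
    have "(f' t)\<^sup>2 \<le> f' t"
      using pos[OF t] lt1[OF t] by (simp add: power2_eq_square mult_le_cancel_left1)
    then show "1 - f' t \<le> 4 / (f t)\<^sup>2"
      using light[OF t] by linarith
  qed simp
  then obtain \<tau> where "((\<lambda>t. t - f t) \<longlongrightarrow> \<tau>) at_top" ..
  then have "((\<lambda>t. \<bar>\<tau> - (t - f t)\<bar>) \<longlongrightarrow> \<bar>\<tau> - \<tau>\<bar>) at_top"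
    by (intro tendsto_intros)
  then show ?thesis
    by (intro exI[of _ \<tau>]) (simp add: algebra_simps)
qed

end
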